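(* Let $\mu\in\mathcal P$ and let $Y_N\subset Y$ be a finite dimensional subspace. Let $(u,y,p)\in U_{ad}\times Y\times Y$ be the solution of the optimality system \begin{align*} & a(y,v;\mu)=b(u,v;\mu)+f(v;\mu)\quad\forall v\in Y,\\ & a(v,p;\mu)=(y-z,v)_{L^2(\Omega_0)}\quad\forall v\in Y,\\ & b(v-u,p;\mu)+\alpha(u,v-u)_U\ge 0\quad\forall v\in U_{ad}, \end{align*} and let $(u_N,y_N,p_N)\in U_{ad}\times Y_N\times Y_N$ be the solution of the reduced optimality system \begin{align*} & a(y_N,v_N;\mu)=b(u_N,v_N;\mu)+f(v_N;\mu)\quad\forall v_N\in Y_N,\\ & a(v_N,p_N;\mu)=(y_N-z,v_N)_{L^2(\Omega_0)}\quad\forall v_N\in Y_N,\\ & b(v-u_N,p_N;\mu)+\alpha(u_N,v-u_N)_U\ge 0\quad\forall v\in U_{ad}. \end{align*} Define $r_y(\cdot;\mu),r_p(\cdot;\mu)\in Y^\ast$ by $$r_y(v;\mu):=b(u_N,v;\mu)+f(v;\mu)-a(y_N,v;\mu),\qquad r_p(v;\mu):=(y_N-z,v)_{L^2(\Omega_0)}-a(v,p_N;\mu)\qquad\forall v\in Y.$$ Then $$\delta_{uyp}(\mu)\le \|u-u_N\|_U+\|y-y_N\|_Y+\|p-p_N\|_Y\le \Delta_{uyp}(\mu),$$ where \begin{align*} \Delta_{uyp}(\mu)&:=c_1(\mu)\|r_y(\cdot;\mu)\|_{Y^\ast}+c_2(\mu)\|r_p(\cdot;\mu)\|_{Y^\ast},\\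 \delta_{uyp}(\mu)&:=c_3(\mu)\|r_y(\cdot;\mu)\|_{Y^\ast}+c_4(\mu)\|r_p(\cdot;\mu)\|_{Y^\ast},\\ c_1(\mu)&:=\frac{1}{\beta(\mu)}\Big[\frac{1}{\rho_1\sqrt{\alpha}}+\Big(1+\frac{1}{\rho_1^2\beta(\mu)}\Big)\Big(\frac{\kappa(\mu)}{\beta(\mu)\rho_1\sqrt{\alpha}}+1\Big)\Big],\\ c_2(\mu)&:=\frac{1}{\beta(\mu)}\Big(\frac{\kappa(\mu)}{\alpha}+\frac{\kappa(\mu)^2}{\beta(\mu)\alpha}+\frac{\kappa(\mu)^2}{\rho_1^2\beta(\mu)^2\alpha}+1\Big),\\ c_3(\mu)&:=\frac{1}{2\gamma(\mu)}\max\Big(\frac{\kappa(\mu)}{\beta(\mu)},1\Big)^{-1},\\ c_4(\mu)&:=\frac{1}{2\gamma(\mu)}\max\Big(\frac{1}{\rho_1^2\beta(\mu)},1\Big)^{-1}. \end{align*}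
   Context: Setting. $\mathcal P\subset\mathbb R^p$ is a compact set of parameters. $\Omega\subset\mathbb R^d$, $d\in\{1,2,3\}$, is a bounded domain and $\Omega_0\subseteq\Omega$ an open subset. $Y$ is a (conforming) space of piecewise linear continuous finite elements, i.e. a finite dimensional subspace of $H^1(\Omega)$, equipped with an inner product $(\cdot,\cdot)_Y$ and norm $\|\cdot\|_Y=\sqrt{(\cdot,\cdot)_Y}$; there are constants $\rho_1,\rho_2>0$ with $\rho_1\|y\|_{H^1(\Omega)}\le\|y\|_Y\le\rho_2\|y\|_{H^1(\Omega)}$ for all $y\in Y$. $Y^\ast$ is the dual of $Y$ with norm $\|l\|_{Y^\ast}=\sup_{\|v\|_Y=1}l(v)$. $U$ is a real Hilbert space with inner product $(\cdot,\cdot)_U$ and norm $\|\cdot\|_U$, and $U_{ad}\subseteq U$ is non-empty, closed and convex. $z\in L^2(\Omega_0)$ and $\alpha>0$ are given. For each $\mu\in\mathcal P$: $a(\cdot,\cdot;\mu):Y\times Y\to\mathbb R$ is bilinear with $$\gamma(\mu):=\sup_{y,v\in Y\setminus\{0\}}\frac{|a(y,v;\mu)|}{\|y\|_Y\|v\|_Y}\le\gamma_0<\infty,\qquad \beta(\mu):=\inf_{y\in Y\setminus\{0\}}\frac{a(y,y;\mu)}{\|y\|_Y^2}\ge\beta_0>0;$$ $b(\cdot,\cdot;\mu):U\times Y\to\mathbb R$ is bilinear with $$\kappa(\mu):=\sup_{u\in U\setminus\{0\},\,v\in Y\setminus\{0\}}\frac{|b(u,v;\mu)|}{\|u\|_U\|v\|_Y}\le\kappa_0<\infty;$$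 $f(\cdot;\mu)\in Y^\ast$ with $\sup_{v\in Y\setminus\{0\}}|f(v;\mu)|/\|v\|_Y\le\sigma_0<\infty$. The constants $\gamma_0,\beta_0,\kappa_0,\sigma_0$ do not depend on $\mu$. The first system in the claim is the (necessary and sufficient) optimality system of the problem of minimizing $\frac12\|y-z\|_{L^2(\Omega_0)}^2+\frac\alpha2\|u\|_U^2$ over $(u,y)\in U_{ad}\times Y$ subject to $a(y,v;\mu)=b(u,v;\mu)+f(v;\mu)$ for all $v\in Y$; the second is that of the same problem with $Y$ replaced by $Y_N$ (the control still ranging over $U_{ad}$). Both problems have unique solutions. *)

theory Defs
  imports "HOL-Analysis.Analysis"
begin

text \<open>Lebesgue-measurable functions modulo equality almost everywhere. Since a type cannot
  depend on a set \<open>\<Omega>\<close>, a class of functions on \<open>\<Omega>\<close> is identified with its extension by zero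
  to the whole space; see \<open>L2\<close> below.\<close>

quotient_type (overloaded) 'a ae_fun = "'a::euclidean_space \<Rightarrow> real" / partial:
  "\<lambda>f g. f \<in> borel_measurable lebesgue \<and> g \<in> borel_measurable lebesgue \<and>
     (AE x in lebesgue. f x = g x)"
  by (rule part_equivpI)
     (auto simp: symp_def transp_def intro!: exI[of _ "\<lambda>_. 0"]
        elim: eventually_mono eventually_elim2)

instantiation ae_fun :: (euclidean_space) real_vector
begin

lift_definition zero_ae_fun :: "'a ae_fun" is "\<lambda>_. 0" by simp

lift_definition plus_ae_fun :: "'a ae_fun \<Rightarrow> 'a ae_fun \<Rightarrow> 'a ae_fun" is "\<lambda>f g x. f x + g x"
  by (auto elim: eventually_elim2)

lift_definition minus_ae_fun :: "'a ae_fun \<Rightarrow> 'a ae_fun \<Rightarrow> 'a ae_fun" is "\<lambda>f g x. f x - g x"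
  by (auto elim: eventually_elim2)

lift_definition uminus_ae_fun :: "'a ae_fun \<Rightarrow> 'a ae_fun" is "\<lambda>f x. - f x"
  by auto

lift_definition scaleR_ae_fun :: "real \<Rightarrow> 'a ae_fun \<Rightarrow> 'a ae_fun" is "\<lambda>c f x. c * f x"
  by (auto elim: eventually_mono)

instance
  by standard (transfer; auto simp: algebra_simps)+

end

text \<open>\<open>rep_ae_fun\<close> picks a representative; everything below is independent of the choice.\<close>

lemma rep_ae_fun_measurable: "rep_ae_fun y \<in> borel_measurable lebesgue"
  using Quotient3_rep_reflp[OF Quotient3_ae_fun, of y] by simp

lemma rep_abs_ae_fun:
  "f \<in> borel_measurable lebesgue \<Longrightarrow> AE x in lebesgue. rep_ae_fun (abs_ae_fun f) x = f x"
  using rep_abs_rsp[OF Quotient3_ae_fun, of f f]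
  by (auto elim: eventually_mono)

definition L2 :: "'a::euclidean_space set \<Rightarrow> 'a ae_fun set" where
  "L2 S = {y. (AE x in lebesgue. x \<notin> S \<longrightarrow> rep_ae_fun y x = 0) \<and>
              set_integrable lebesgue S (\<lambda>x. (rep_ae_fun y x)\<^sup>2)}"

definition L2_inner :: "'a::euclidean_space set \<Rightarrow> 'a ae_fun \<Rightarrow> 'a ae_fun \<Rightarrow> real" where
  "L2_inner S y v = (LINT x:S|lebesgue. rep_ae_fun y x * rep_ae_fun v x)"

text \<open>\<open>k\<close>-times continuously differentiable functions, through iterated partial derivatives.\<close>

primrec C_k :: "nat \<Rightarrow> ('a::euclidean_space \<Rightarrow> real) \<Rightarrow> bool" where
  "C_k 0 \<phi> \<longleftrightarrow> continuous_on UNIV \<phi>"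
| "C_k (Suc k) \<phi> \<longleftrightarrow> \<phi> differentiable_on UNIV \<and>
     (\<forall>i\<in>Basis. C_k k (\<lambda>x. frechet_derivative \<phi> (at x) i))"

definition test_function :: "'a::euclidean_space set \<Rightarrow> ('a \<Rightarrow> real) \<Rightarrow> bool" where
  "test_function \<Omega> \<phi> \<longleftrightarrow> (\<forall>k. C_k k \<phi>) \<and>
     compact (closure {x. \<phi> x \<noteq> 0}) \<and> closure {x. \<phi> x \<noteq> 0} \<subseteq> \<Omega>"

definition has_weak_partial ::
  "'a::euclidean_space set \<Rightarrow> 'a \<Rightarrow> 'a ae_fun \<Rightarrow> 'a ae_fun \<Rightarrow> bool" where
  "has_weak_partial \<Omega> i y g \<longleftrightarrow> (\<forall>\<phi>. test_function \<Omega> \<phi> \<longrightarrow>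
     (LINT x:\<Omega>|lebesgue. rep_ae_fun y x * frechet_derivative \<phi> (at x) i) =
     - (LINT x:\<Omega>|lebesgue. rep_ae_fun g x * \<phi> x))"

definition weak_partial :: "'a::euclidean_space set \<Rightarrow> 'a \<Rightarrow> 'a ae_fun \<Rightarrow> 'a ae_fun" where
  "weak_partial \<Omega> i y = (THE g. g \<in> L2 \<Omega> \<and> has_weak_partial \<Omega> i y g)"

definition H1 :: "'a::euclidean_space set \<Rightarrow> 'a ae_fun set" where
  "H1 \<Omega> = {y \<in> L2 \<Omega>. \<forall>i\<in>Basis. \<exists>g\<in>L2 \<Omega>. has_weak_partial \<Omega> i y g}"

definition H1_norm :: "'a::euclidean_space set \<Rightarrow> 'a ae_fun \<Rightarrow> real" where
  "H1_norm \<Omega> y = sqrt (L2_inner \<Omega> y y +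
     (\<Sum>i\<in>Basis. L2_inner \<Omega> (weak_partial \<Omega> i y) (weak_partial \<Omega> i y)))"

text \<open>Continuous piecewise linear finite elements. The mesh is only required to cover \<open>\<Omega>\<close>, so
  that polyhedral and non-polyhedral domains are both admitted.\<close>

definition continuous_piecewise_linear ::
  "'a::euclidean_space set set \<Rightarrow> 'a set \<Rightarrow> ('a \<Rightarrow> real) \<Rightarrow> bool" where
  "continuous_piecewise_linear \<T> \<Omega> g \<longleftrightarrow> continuous_on \<Omega> g \<and>
     (\<forall>K\<in>\<T>. \<exists>c d. \<forall>x\<in>K \<inter> \<Omega>. g x = c \<bullet> x + d)"

definition P1_finite_element_space :: "'a::euclidean_space set \<Rightarrow> 'a ae_fun set \<Rightarrow> bool" where
  "P1_finite_element_space \<Omega> Y \<longleftrightarrow>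
     Y \<subseteq> H1 \<Omega> \<and> subspace Y \<and> (\<exists>B. finite B \<and> span B = Y) \<and>
     (\<exists>\<T>. triangulation \<T> \<and> \<Omega> \<subseteq> \<Union>\<T> \<and>
        (\<forall>y\<in>Y. \<exists>g. continuous_piecewise_linear \<T> \<Omega> g \<and>
           (AE x in lebesgue. x \<in> \<Omega> \<longrightarrow> rep_ae_fun y x = g x)))"

definition linear_form_on :: "'v::real_vector set \<Rightarrow> ('v \<Rightarrow> real) \<Rightarrow> bool" where
  "linear_form_on V l \<longleftrightarrow> (\<forall>x\<in>V. \<forall>y\<in>V. l (x + y) = l x + l y) \<and>
     (\<forall>c. \<forall>x\<in>V. l (c *\<^sub>R x) = c * l x)"

definition bilinear_form_on ::
  "'v::real_vector set \<Rightarrow> 'w::real_vector set \<Rightarrow> ('v \<Rightarrow> 'w \<Rightarrow> real) \<Rightarrow> bool" where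
  "bilinear_form_on V W b \<longleftrightarrow> (\<forall>v\<in>V. linear_form_on W (b v)) \<and>
     (\<forall>w\<in>W. linear_form_on V (\<lambda>v. b v w))"

definition inner_product_on :: "'v::real_vector set \<Rightarrow> ('v \<Rightarrow> 'v \<Rightarrow> real) \<Rightarrow> bool" where
  "inner_product_on V ip \<longleftrightarrow> bilinear_form_on V V ip \<and>
     (\<forall>x\<in>V. \<forall>y\<in>V. ip x y = ip y x) \<and> (\<forall>x\<in>V. x \<noteq> 0 \<longrightarrow> ip x x > 0)"

definition ip_norm :: "('v \<Rightarrow> 'v \<Rightarrow> real) \<Rightarrow> 'v \<Rightarrow> real" where
  "ip_norm ip v = sqrt (ip v v)"

text \<open>The suprema and infima are taken in the extended reals, so that \<open>\<le> ereal C\<close> really expresses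
  boundedness. For a trivial space the index set is empty; the value then is infinite and
  \<open>real_of_ereal\<close> sends it to \<open>0\<close>.\<close>

definition continuity_const ::
  "'v::real_vector set \<Rightarrow> ('v \<Rightarrow> real) \<Rightarrow> 'w::real_vector set \<Rightarrow> ('w \<Rightarrow> real) \<Rightarrow>
     ('v \<Rightarrow> 'w \<Rightarrow> real) \<Rightarrow> ereal" where
  "continuity_const V nV W nW b =
     (SUP (v, w) \<in> (V - {0}) \<times> (W - {0}). ereal (\<bar>b v w\<bar> / (nV v * nW w)))"

definition coercivity_const ::
  "'v::real_vector set \<Rightarrow> ('v \<Rightarrow> real) \<Rightarrow> ('v \<Rightarrow> 'v \<Rightarrow> real) \<Rightarrow> ereal" where
  "coercivity_const V nV a = (INF v \<in> V - {0}. ereal (a v v / (nV v)\<^sup>2))"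

definition functional_bound ::
  "'v::real_vector set \<Rightarrow> ('v \<Rightarrow> real) \<Rightarrow> ('v \<Rightarrow> real) \<Rightarrow> ereal" where
  "functional_bound V nV l = (SUP v \<in> V - {0}. ereal (\<bar>l v\<bar> / nV v))"

definition dual_norm :: "'v set \<Rightarrow> ('v \<Rightarrow> real) \<Rightarrow> ('v \<Rightarrow> real) \<Rightarrow> real" where
  "dual_norm V nV l = real_of_ereal (SUP v \<in> {v \<in> V. nV v = 1}. ereal (l v))"

text \<open>The forms are those at a fixed parameter. Taking for \<open>V\<close> the full space or the reduced space
  gives the two systems.\<close>

definition optimality_system ::
  "'a::euclidean_space set \<Rightarrow> 'a ae_fun \<Rightarrow> real \<Rightarrow> 'u::real_inner set \<Rightarrow> 'a ae_fun set \<Rightarrow>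
     ('a ae_fun \<Rightarrow> 'a ae_fun \<Rightarrow> real) \<Rightarrow> ('u \<Rightarrow> 'a ae_fun \<Rightarrow> real) \<Rightarrow> ('a ae_fun \<Rightarrow> real) \<Rightarrow>
     'u \<Rightarrow> 'a ae_fun \<Rightarrow> 'a ae_fun \<Rightarrow> bool" where
  "optimality_system \<Omega>\<^sub>0 z \<alpha> Uad V a b f u y p \<longleftrightarrow>
     u \<in> Uad \<and> y \<in> V \<and> p \<in> V \<and>
     (\<forall>v\<in>V. a y v = b u v + f v) \<and>
     (\<forall>v\<in>V. a v p = L2_inner \<Omega>\<^sub>0 (y - z) v) \<and>
     (\<forall>v\<in>Uad. b (v - u) p + \<alpha> * (u \<bullet> (v - u)) \<ge> 0)"

definition state_residual ::
  "('v \<Rightarrow> 'v \<Rightarrow> real) \<Rightarrow> ('u \<Rightarrow> 'v \<Rightarrow> real) \<Rightarrow> ('v \<Rightarrow> real) \<Rightarrow> 'u \<Rightarrow> 'v \<Rightarrow> 'v \<Rightarrow> real" where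
  "state_residual a b f u\<^sub>N y\<^sub>N v = b u\<^sub>N v + f v - a y\<^sub>N v"

definition adjoint_residual ::
  "'a::euclidean_space set \<Rightarrow> 'a ae_fun \<Rightarrow> ('a ae_fun \<Rightarrow> 'a ae_fun \<Rightarrow> real) \<Rightarrow>
     'a ae_fun \<Rightarrow> 'a ae_fun \<Rightarrow> 'a ae_fun \<Rightarrow> real" where
  "adjoint_residual \<Omega>\<^sub>0 z a y\<^sub>N p\<^sub>N v = L2_inner \<Omega>\<^sub>0 (y\<^sub>N - z) v - a v p\<^sub>N"

definition c1 :: "real \<Rightarrow> real \<Rightarrow> real \<Rightarrow> real \<Rightarrow> real" where
  "c1 \<beta> \<kappa> \<rho>\<^sub>1 \<alpha> = 1 / \<beta> * (1 / (\<rho>\<^sub>1 * sqrt \<alpha>) +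
     (1 + 1 / (\<rho>\<^sub>1\<^sup>2 * \<beta>)) * (\<kappa> / (\<beta> * \<rho>\<^sub>1 * sqrt \<alpha>) + 1))"

definition c2 :: "real \<Rightarrow> real \<Rightarrow> real \<Rightarrow> real \<Rightarrow> real" where
  "c2 \<beta> \<kappa> \<rho>\<^sub>1 \<alpha> = 1 / \<beta> * (\<kappa> / \<alpha> + \<kappa>\<^sup>2 / (\<beta> * \<alpha>) + \<kappa>\<^sup>2 / (\<rho>\<^sub>1\<^sup>2 * \<beta>\<^sup>2 * \<alpha>) + 1)"

definition c3 :: "real \<Rightarrow> real \<Rightarrow> real \<Rightarrow> real" where
  "c3 \<gamma> \<beta> \<kappa> = 1 / (2 * \<gamma>) * inverse (max (\<kappa> / \<beta>) 1)"

definition c4 :: "real \<Rightarrow> real \<Rightarrow> real \<Rightarrow> real" where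
  "c4 \<gamma> \<beta> \<rho>\<^sub>1 = 1 / (2 * \<gamma>) * inverse (max (1 / (\<rho>\<^sub>1\<^sup>2 * \<beta>)) 1)"

end

theory Submission
  imports Defs
begin

text \<open>Write \<open>eu\<close>, \<open>ey\<close>, \<open>ep\<close> for the three errors, so that \<open>a ey v = b eu v + ry v\<close> and
  \<open>a v ep = (ey, v) + rp v\<close> on \<open>Y\<close>. Testing each variational inequality with the other control
  gives \<open>\<alpha> |eu|\<^sup>2 \<le> - b eu ep\<close>. Let \<open>w\<close> and \<open>q\<close> be the Riesz-type lifts \<open>a w v = ry v\<close> and
  \<open>a v q = rp v\<close>, which exist by coercivity in finite dimension. Then
  \<open>b eu (ep - q) = a (ey - w) (ep - q) = (ey, ey - w)\<close>, hence
  \<open>\<alpha> |eu|\<^sup>2 + |ey|\<^sup>2 \<le> \<bar>b eu q\<bar> + \<bar>(ey, w)\<bar>\<close> in the \<open>L\<^sup>2\<close> seminorm of \<open>ey\<close>; this bounds \<open>eu\<close>, and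
  coercivity then bounds \<open>ey\<close> and \<open>ep\<close>. The lower bound follows by estimating the residuals through
  the continuity constants, with \<open>\<beta> \<le> \<gamma>\<close>.\<close>

section \<open>Linear and bilinear forms\<close>

lemma linear_form_on_add:
  "linear_form_on V l \<Longrightarrow> x \<in> V \<Longrightarrow> y \<in> V \<Longrightarrow> l (x + y) = l x + l y"
  by (simp add: linear_form_on_def)

lemma linear_form_on_scaleR:
  "linear_form_on V l \<Longrightarrow> x \<in> V \<Longrightarrow> l (c *\<^sub>R x) = c * l x"
  by (simp add: linear_form_on_def)

lemma linear_form_on_minus:
  "linear_form_on V l \<Longrightarrow> x \<in> V \<Longrightarrow> l (- x) = - l x"
  using linear_form_on_scaleR[of V l x "-1"] by simp

lemma linear_form_on_zero:
  "linear_form_on V l \<Longrightarrow> 0 \<in> V \<Longrightarrow> l 0 = 0"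
  using linear_form_on_scaleR[of V l 0 0] by simp

lemma linear_form_on_diff:
  assumes "linear_form_on V l" "subspace V" "x \<in> V" "y \<in> V"
  shows "l (x - y) = l x - l y"
  using linear_form_on_add[of V l x "- y"] linear_form_on_minus[of V l y] assms
  by (simp add: subspace_neg)

lemma linear_form_on_subset:
  "linear_form_on V l \<Longrightarrow> W \<subseteq> V \<Longrightarrow> linear_form_on W l"
  unfolding linear_form_on_def by blast

lemma bilinear_form_on_left: "bilinear_form_on V W b \<Longrightarrow> w \<in> W \<Longrightarrow> linear_form_on V (\<lambda>v. b v w)"
  by (simp add: bilinear_form_on_def)

lemma bilinear_form_on_right: "bilinear_form_on V W b \<Longrightarrow> v \<in> V \<Longrightarrow> linear_form_on W (b v)"
  by (simp add: bilinear_form_on_def)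

lemma bilinear_form_on_flip: "bilinear_form_on V W b \<Longrightarrow> bilinear_form_on W V (\<lambda>w v. b v w)"
  by (simp add: bilinear_form_on_def)

lemma bilinear_form_on_subset:
  "bilinear_form_on V V b \<Longrightarrow> W \<subseteq> V \<Longrightarrow> bilinear_form_on W W b"
  unfolding bilinear_form_on_def using linear_form_on_subset by blast

text \<open>Only semidefiniteness is assumed, because the L2 product on
  \<open>\<Omega>\<^sub>0\<close> may vanish at nonzero elements of \<open>Y\<close>. The bound
  comes from a quadratic polynomial in \<open>t\<close> that is never negative.\<close>

lemma Cauchy_Schwarz_bilinear_form_on:
  assumes bil: "bilinear_form_on V V m" and V: "subspace V"
    and sym: "\<And>x y. x \<in> V \<Longrightarrow> y \<in> V \<Longrightarrow> m x y = m y x"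
    and psd: "\<And>x. x \<in> V \<Longrightarrow> 0 \<le> m x x"
    and x: "x \<in> V" and y: "y \<in> V"
  shows "\<bar>m x y\<bar> \<le> sqrt (m x x) * sqrt (m y y)"
proof -
  have quad: "0 \<le> m x x + 2 * t * m x y + t\<^sup>2 * m y y" for t
  proof -
    have V': "t *\<^sub>R y \<in> V" "x + t *\<^sub>R y \<in> V"
      using V x y by (auto simp: subspace_add subspace_scale)
    have "m (x + t *\<^sub>R y) (x + t *\<^sub>R y) = m x x + 2 * t * m x y + t\<^sup>2 * m y y"
      using linear_form_on_add[OF bilinear_form_on_left[OF bil V'(2)] x V'(1)]
        linear_form_on_scaleR[OF bilinear_form_on_left[OF bil V'(2)] y, of t]
        linear_form_on_add[OF bilinear_form_on_right[OF bil x] x V'(1)]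
        linear_form_on_scaleR[OF bilinear_form_on_right[OF bil x] y, of t]
        linear_form_on_add[OF bilinear_form_on_right[OF bil y] x V'(1)]
        linear_form_on_scaleR[OF bilinear_form_on_right[OF bil y] y, of t]
        sym[OF x y]
      by (simp add: algebra_simps power2_eq_square)
    then show ?thesis using psd[OF V'(2)] by simp
  qed
  have "(m x y)\<^sup>2 \<le> m x x * m y y"
  proof (cases "m y y = 0")
    case True
    \<comment> \<open>Without its quadratic term the polynomial is affine in \<open>t\<close>; the
      \<open>t\<close> inserted below would give it the value -1.\<close>
    have "m x y = 0"
    proof (rule ccontr)
      assume "m x y \<noteq> 0"
      with quad[of "- (m x x + 1) / (2 * m x y)"] True show False by (simp add: field_simps)
    qed
    then show ?thesis using True by simp
  next
    case False
    with psd[OF y] have pos: "m y y > 0" by simp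
    \<comment> \<open>The inserted \<open>t\<close> is the minimiser of the polynomial.\<close>
    have "0 \<le> m x x - (m x y)\<^sup>2 / m y y"
      using quad[of "- m x y / m y y"] pos by (simp add: field_simps power2_eq_square)
    then show ?thesis using pos by (simp add: field_simps)
  qed
  then have "sqrt ((m x y)\<^sup>2) \<le> sqrt (m x x * m y y)" by (rule real_sqrt_le_mono)
  then show ?thesis by (simp add: real_sqrt_mult)
qed

text \<open>When a vector \<open>x\<close> is added to the span, it is first made left orthogonal to the span;
  the solution is then corrected by a multiple of the resulting vector.\<close>

lemma lax_milgram_span:
  assumes "finite B" and "bilinear_form_on (span B) (span B) a"
    and "\<And>v. v \<in> span B \<Longrightarrow> v \<noteq> 0 \<Longrightarrow> 0 < a v v"
    and "linear_form_on (span B) l"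
  shows "\<exists>w\<in>span B. \<forall>v\<in>span B. a w v = l v"
  using assms
proof (induction B arbitrary: l rule: finite_induct)
  case empty
  then show ?case
    using linear_form_on_zero[OF empty(3)]
      linear_form_on_zero[OF bilinear_form_on_right[OF empty(1), of 0]]
    by auto
next
  case (insert x B)
  let ?W = "span (insert x B)"
  have sub: "span B \<subseteq> ?W" by (simp add: span_mono subset_insertI)
  have xW: "x \<in> ?W" by (simp add: span_base)
  have bilB: "bilinear_form_on (span B) (span B) a"
    using insert.prems(1) sub by (rule bilinear_form_on_subset)
  have IH: "\<exists>w\<in>span B. \<forall>v\<in>span B. a w v = g v" if "linear_form_on ?W g" for g
    using insert.IH[OF bilB _ linear_form_on_subset[OF that sub]] insert.prems(2) sub by blast
  show ?case
  proof (cases "x \<in> span B")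
    case True
    then have "?W = span B" by (rule span_redundant)
    then show ?thesis using IH[OF insert.prems(3)] by simp
  next
    case False
    obtain w0 where w0: "w0 \<in> span B" "\<And>v. v \<in> span B \<Longrightarrow> a w0 v = l v"
      using IH[OF insert.prems(3)] by blast
    obtain t where t: "t \<in> span B" "\<And>v. v \<in> span B \<Longrightarrow> a t v = a x v"
      using IH[OF bilinear_form_on_right[OF insert.prems(1) xW]] by blast
    define e where "e = x - t"
    have eW: "e \<in> ?W" using t(1) sub xW by (auto simp: e_def intro: span_diff)
    have "e \<noteq> 0" using False t(1) by (auto simp: e_def)
    then have pos: "0 < a e e" using insert.prems(2) eW by blast
    have orth: "a e v = 0" if "v \<in> span B" for v
      using linear_form_on_diff[OF bilinear_form_on_left[OF insert.prems(1)] subspace_span xW, of v t]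
        t(1) t(2)[OF that] that sub by (auto simp: e_def)
    \<comment> \<open>Adding a multiple of \<open>e\<close> leaves the equations on
      \<open>span B\<close> intact by \<open>orth\<close>; this \<open>c\<close> enforces the
      remaining one, \<open>a w e = l e\<close>.\<close>
    define c where "c = (l e - a w0 e) / a e e"
    define w where "w = w0 + c *\<^sub>R e"
    have wW: "w \<in> ?W" using w0(1) sub eW by (auto simp: w_def intro: span_add span_scale)
    have expand: "a w v = a w0 v + c * a e v" if "v \<in> ?W" for v
      using linear_form_on_add[OF bilinear_form_on_left[OF insert.prems(1) that], of w0 "c *\<^sub>R e"]
        linear_form_on_scaleR[OF bilinear_form_on_left[OF insert.prems(1) that] eW, of c]
        w0(1) sub eW by (auto simp: w_def intro: span_scale)
    have "a w v = l v" if "v \<in> ?W" for v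
    proof -
      \<comment> \<open>With \<open>e\<close> replacing \<open>x\<close> as the extra generator,
        \<open>v\<close> splits into a part in \<open>span B\<close> and a multiple of
        \<open>e\<close>, so it suffices that both sides agree on \<open>span B\<close> and at
        \<open>e\<close>.\<close>
      obtain k where k: "v - k *\<^sub>R x \<in> span B" using span_breakdown_eq[of v x B] \<open>v \<in> ?W\<close> by blast
      define v0 where "v0 = v - k *\<^sub>R e"
      have "v0 = (v - k *\<^sub>R x) + k *\<^sub>R t" by (simp add: v0_def e_def algebra_simps)
      then have v0: "v0 \<in> span B" using k t(1) by (auto intro: span_add span_scale)
      have v: "v = v0 + k *\<^sub>R e" by (simp add: v0_def)
      have keW: "k *\<^sub>R e \<in> ?W" using eW by (rule span_scale)
      have lin: "g v = g v0 + k * g e" if "linear_form_on ?W g" for g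
        unfolding v using linear_form_on_add[OF that _ keW] linear_form_on_scaleR[OF that eW] v0 sub
        by auto
      have "a w v0 = l v0" using expand v0 sub w0(2) orth by auto
      moreover have "a w e = l e" using expand[OF eW] pos by (simp add: c_def)
      ultimately show ?thesis
        using lin[OF bilinear_form_on_right[OF insert.prems(1) wW]] lin[OF insert.prems(3)] by simp
    qed
    then show ?thesis using wW by blast
  qed
qed

section \<open>Norms and constants of forms\<close>

lemma ip_norm_zero: "inner_product_on V ip \<Longrightarrow> 0 \<in> V \<Longrightarrow> ip_norm ip 0 = 0"
  using linear_form_on_zero[OF bilinear_form_on_right]
  by (auto simp: inner_product_on_def ip_norm_def)

lemma ip_norm_pos: "inner_product_on V ip \<Longrightarrow> v \<in> V \<Longrightarrow> v \<noteq> 0 \<Longrightarrow> 0 < ip_norm ip v"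
  by (simp add: inner_product_on_def ip_norm_def)

lemma ip_norm_nonneg: "inner_product_on V ip \<Longrightarrow> v \<in> V \<Longrightarrow> 0 \<le> ip_norm ip v"
  using ip_norm_pos[of V ip v] ip_norm_zero[of V ip] by (cases "v = 0") auto

lemma ip_norm_scaleR:
  assumes "inner_product_on V ip" "subspace V" "v \<in> V"
  shows "ip_norm ip (c *\<^sub>R v) = \<bar>c\<bar> * ip_norm ip v"
proof -
  have bil: "bilinear_form_on V V ip" using assms by (simp add: inner_product_on_def)
  have "c *\<^sub>R v \<in> V" using assms by (simp add: subspace_scale)
  then have "ip (c *\<^sub>R v) (c *\<^sub>R v) = c\<^sup>2 * ip v v"
    using linear_form_on_scaleR[OF bilinear_form_on_left[OF bil] assms(3)]
      linear_form_on_scaleR[OF bilinear_form_on_right[OF bil assms(3)] assms(3)]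
    by (simp add: power2_eq_square)
  then show ?thesis by (simp add: ip_norm_def real_sqrt_mult)
qed

text \<open>\<open>dual_norm\<close> converts an extended real supremum, and an infinite one would
  silently become 0. The bound by \<open>C\<close> excludes \<infinity>, and a nonzero vector in
  \<open>V\<close> excludes -\<infinity>; the trivial space is treated apart.\<close>

context
  fixes V :: "'v::real_vector set" and ip l and C :: real
  assumes ip: "inner_product_on V ip" and V: "subspace V" and l: "linear_form_on V l"
    and bound: "\<And>v. v \<in> V \<Longrightarrow> l v \<le> C * ip_norm ip v"
begin

lemma dual_norm_trivial:
  assumes "V = {0}" shows "dual_norm V (ip_norm ip) l = 0"
proof -
  \<comment> \<open>The supremum over the empty set is -\<infinity>, which is converted to
    0.\<close>
  have "{v \<in> V. ip_norm ip v = 1} = {}" using assms ip_norm_zero[OF ip] by auto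
  then show ?thesis by (simp only: dual_norm_def) (simp add: bot_ereal_def)
qed

lemma ereal_dual_norm:
  assumes "v \<in> V" "v \<noteq> 0"
  shows "ereal (dual_norm V (ip_norm ip) l) = (SUP v \<in> {v \<in> V. ip_norm ip v = 1}. ereal (l v))"
    (is "_ = ?S")
proof -
  \<comment> \<open>This unit vector makes the index set of the supremum nonempty.\<close>
  define w where "w = (1 / ip_norm ip v) *\<^sub>R v"
  have "w \<in> V" "ip_norm ip w = 1"
    using ip_norm_scaleR[OF ip V assms(1)] ip_norm_pos[OF ip assms] V assms
    by (auto simp: w_def subspace_scale)
  then have "ereal (l w) \<le> ?S" by (intro SUP_upper) auto
  moreover have "?S \<le> ereal C" using bound by (intro SUP_least) fastforce
  ultimately show ?thesis unfolding dual_norm_def by (intro ereal_real') auto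
qed

lemma abs_le_dual_norm:
  assumes v: "v \<in> V"
  shows "\<bar>l v\<bar> \<le> dual_norm V (ip_norm ip) l * ip_norm ip v"
proof (cases "v = 0")
  case True
  then show ?thesis using linear_form_on_zero[OF l] ip_norm_zero[OF ip] v by simp
next
  case False
  have pos: "0 < ip_norm ip v" using ip_norm_pos[OF ip v False] .
  \<comment> \<open>The supremum is over \<open>l\<close> without absolute value, so both
    normalisations of \<open>v\<close>, with either sign, are compared with it.\<close>
  have "l (c *\<^sub>R v) \<le> dual_norm V (ip_norm ip) l" if "\<bar>c\<bar> = 1 / ip_norm ip v" for c
  proof -
    have "ereal (l (c *\<^sub>R v)) \<le> (SUP v \<in> {v \<in> V. ip_norm ip v = 1}. ereal (l v))"
      using ip_norm_scaleR[OF ip V v, of c] that pos V v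
      by (intro SUP_upper) (auto simp: subspace_scale)
    then show ?thesis using ereal_dual_norm[OF v False] by (metis ereal_less_eq(3))
  qed
  from this[of "1 / ip_norm ip v"] this[of "- (1 / ip_norm ip v)"] pos
  show ?thesis
    by (simp only: linear_form_on_scaleR[OF l v]) (simp add: field_simps abs_le_iff)
qed

lemma dual_norm_nonneg: "0 \<le> dual_norm V (ip_norm ip) l"
proof (cases "V = {0}")
  case False
  then obtain v where v: "v \<in> V" "v \<noteq> 0" using subspace_0[OF V] by auto
  have "0 \<le> dual_norm V (ip_norm ip) l * ip_norm ip v"
    using abs_le_dual_norm[OF v(1)] by linarith
  then show ?thesis using ip_norm_pos[OF ip v] by (simp add: zero_le_mult_iff)
qed (use dual_norm_trivial in simp)

text \<open>The sign condition on \<open>C\<close> covers \<open>V = {0}\<close>, where the dual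
  norm is 0 by convention.\<close>

lemma dual_norm_le:
  assumes "0 \<le> C" shows "dual_norm V (ip_norm ip) l \<le> C"
proof (cases "V = {0}")
  case False
  then obtain v where v: "v \<in> V" "v \<noteq> 0" using subspace_0[OF V] by auto
  have "(SUP v \<in> {v \<in> V. ip_norm ip v = 1}. ereal (l v)) \<le> ereal C"
    using bound by (intro SUP_least) fastforce
  then show ?thesis using ereal_dual_norm[OF v] by (metis ereal_less_eq(3))
qed (use dual_norm_trivial assms in simp)

end

section \<open>Continuity and coercivity constants as real numbers\<close>

lemma continuity_const_nonneg:
  assumes "\<And>v. v \<in> V \<Longrightarrow> 0 \<le> nV v" "\<And>w. w \<in> W \<Longrightarrow> 0 \<le> nW w"
  shows "0 \<le> real_of_ereal (continuity_const V nV W nW b)"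
proof (cases "(V - {0}) \<times> (W - {0}) = {}")
  case True
  then show ?thesis by (simp only: continuity_const_def) (simp add: bot_ereal_def)
next
  case False
  then obtain v w where vw: "(v, w) \<in> (V - {0}) \<times> (W - {0})" by auto
  have "0 \<le> ereal (\<bar>b v w\<bar> / (nV v * nW w))" using assms vw by auto
  also have "\<dots> \<le> continuity_const V nV W nW b"
    unfolding continuity_const_def using vw by (intro SUP_upper2[of "(v, w)"]) auto
  finally show ?thesis by (rule real_of_ereal_pos)
qed

text \<open>\<open>C\<close> certifies that the supremum is finite, so that the estimate can carry
  the sharp constant. Zero vectors lie outside the index set; for them both sides vanish.\<close>

lemma abs_le_continuity_const:
  assumes le: "continuity_const V nV W nW b \<le> ereal C" and bil: "bilinear_form_on V W b"
    and nV: "\<And>v. v \<in> V \<Longrightarrow> v \<noteq> 0 \<Longrightarrow> 0 < nV v" "nV 0 = 0"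
    and nW: "\<And>w. w \<in> W \<Longrightarrow> w \<noteq> 0 \<Longrightarrow> 0 < nW w" "nW 0 = 0"
    and v: "v \<in> V" and w: "w \<in> W"
  shows "\<bar>b v w\<bar> \<le> real_of_ereal (continuity_const V nV W nW b) * nV v * nW w"
proof (cases "v = 0 \<or> w = 0")
  case True
  then have "b v w = 0"
    using linear_form_on_zero[OF bilinear_form_on_left[OF bil w]]
      linear_form_on_zero[OF bilinear_form_on_right[OF bil v]] v w by auto
  then show ?thesis using True nV(2) nW(2) by auto
next
  case False
  let ?c = "continuity_const V nV W nW b"
  have up: "ereal (\<bar>b v w\<bar> / (nV v * nW w)) \<le> ?c"
    unfolding continuity_const_def using v w False by (intro SUP_upper2[of "(v, w)"]) auto
  then have "?c = ereal (real_of_ereal ?c)" using le by (intro ereal_real'[symmetric]) auto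
  then have "\<bar>b v w\<bar> / (nV v * nW w) \<le> real_of_ereal ?c" using up by (metis ereal_less_eq(3))
  moreover have "0 < nV v * nW w" using nV nW v w False by simp
  ultimately show ?thesis by (simp add: divide_le_eq mult.assoc)
qed

text \<open>The nonzero \<open>v\<close> keeps the infimum below \<infinity> and \<open>C\<close>
  keeps it above -\<infinity>.\<close>

lemma coercivity_const_finite:
  assumes "ereal C \<le> coercivity_const V n a" "v \<in> V" "v \<noteq> 0"
  shows "C \<le> real_of_ereal (coercivity_const V n a)"
    and "real_of_ereal (coercivity_const V n a) \<le> a v v / (n v)\<^sup>2"
proof -
  let ?c = "coercivity_const V n a"
  have up: "?c \<le> ereal (a v v / (n v)\<^sup>2)"
    unfolding coercivity_const_def using assms by (intro INF_lower) auto
  then have "?c = ereal (real_of_ereal ?c)" using assms(1) by (intro ereal_real'[symmetric]) auto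
  then show "C \<le> real_of_ereal ?c" "real_of_ereal ?c \<le> a v v / (n v)\<^sup>2"
    using up assms(1) by (metis ereal_less_eq(3))+
qed

section \<open>The \<open>L\<^sup>2\<close> inner product\<close>

abbreviation sq_integrable :: "'a::euclidean_space set \<Rightarrow> 'a ae_fun \<Rightarrow> bool" where
  "sq_integrable S y \<equiv> set_integrable lebesgue S (\<lambda>x. (rep_ae_fun y x)\<^sup>2)"

text \<open>The chosen representative of a sum is the sum of the representatives only almost
  everywhere, so linearity of \<open>L2_inner\<close> has to pass through AE congruence of
  integrals.\<close>

lemma rep_ae_fun_add: "AE x in lebesgue. rep_ae_fun (y + v) x = rep_ae_fun y x + rep_ae_fun v x"
  unfolding plus_ae_fun_def map_fun_apply
  by (rule rep_abs_ae_fun) (intro borel_measurable_add rep_ae_fun_measurable)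

lemma rep_ae_fun_scaleR: "AE x in lebesgue. rep_ae_fun (c *\<^sub>R y) x = c * rep_ae_fun y x"
  unfolding scaleR_ae_fun_def map_fun_apply id_apply
  by (rule rep_abs_ae_fun) (intro borel_measurable_times borel_measurable_const rep_ae_fun_measurable)

text \<open>The product is dominated by the sum of the squares. Integrability is what allows
  integrals of sums to be split.\<close>

lemma set_integrable_rep_mult:
  assumes S: "S \<in> sets lebesgue" and y: "sq_integrable S y" and v: "sq_integrable S v"
  shows "set_integrable lebesgue S (\<lambda>x. rep_ae_fun y x * rep_ae_fun v x)"
proof (rule set_integrable_bound[OF set_integral_add(1)[OF y v]])
  show "set_borel_measurable lebesgue S (\<lambda>x. rep_ae_fun y x * rep_ae_fun v x)"
    unfolding set_borel_measurable_def using S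
    by (intro borel_measurable_scaleR borel_measurable_times rep_ae_fun_measurable) simp
  have "\<bar>s * t\<bar> \<le> \<bar>s\<^sup>2 + t\<^sup>2\<bar>" for s t :: real
    using sum_squares_bound[of s t] sum_squares_bound[of s "- t"] by auto
  then show "AE x in lebesgue. x \<in> S \<longrightarrow> norm (rep_ae_fun y x * rep_ae_fun v x)
      \<le> norm ((rep_ae_fun y x)\<^sup>2 + (rep_ae_fun v x)\<^sup>2)" by simp
qed

lemma L2_inner_add_left:
  assumes S: "S \<in> sets lebesgue" and "sq_integrable S y" "sq_integrable S y'" "sq_integrable S v"
  shows "L2_inner S (y + y') v = L2_inner S y v + L2_inner S y' v"
proof -
  have "L2_inner S (y + y') v =
      (LINT x:S|lebesgue. rep_ae_fun y x * rep_ae_fun v x + rep_ae_fun y' x * rep_ae_fun v x)"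
    unfolding L2_inner_def
  proof (rule set_lebesgue_integral_cong_AE[OF S])
    show "AE x\<in>S in lebesgue. rep_ae_fun (y + y') x * rep_ae_fun v x =
        rep_ae_fun y x * rep_ae_fun v x + rep_ae_fun y' x * rep_ae_fun v x"
      using rep_ae_fun_add[of y y'] by eventually_elim (simp add: algebra_simps)
  qed (intro borel_measurable_add borel_measurable_times rep_ae_fun_measurable)+
  then show ?thesis
    using set_integral_add(2)[OF set_integrable_rep_mult set_integrable_rep_mult] assms
    by (simp add: L2_inner_def)
qed

lemma L2_inner_scaleR_left:
  assumes S: "S \<in> sets lebesgue"
  shows "L2_inner S (c *\<^sub>R y) v = c * L2_inner S y v"
proof -
  have "L2_inner S (c *\<^sub>R y) v = (LINT x:S|lebesgue. c * (rep_ae_fun y x * rep_ae_fun v x))"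
    unfolding L2_inner_def
  proof (rule set_lebesgue_integral_cong_AE[OF S])
    show "AE x\<in>S in lebesgue. rep_ae_fun (c *\<^sub>R y) x * rep_ae_fun v x =
        c * (rep_ae_fun y x * rep_ae_fun v x)"
      using rep_ae_fun_scaleR[of c y] by eventually_elim simp
  qed (intro borel_measurable_times borel_measurable_const rep_ae_fun_measurable)+
  then show ?thesis by (simp add: L2_inner_def)
qed

lemma sq_integrable_scaleR:
  assumes S: "S \<in> sets lebesgue" and y: "sq_integrable S y"
  shows "sq_integrable S (c *\<^sub>R y)"
proof -
  have "set_integrable lebesgue S (\<lambda>x. c\<^sup>2 * (rep_ae_fun y x)\<^sup>2)"
    using y by simp
  moreover have "AE x\<in>S in lebesgue. (rep_ae_fun (c *\<^sub>R y) x)\<^sup>2 = c\<^sup>2 * (rep_ae_fun y x)\<^sup>2"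
    using rep_ae_fun_scaleR[of c y] by eventually_elim (simp add: power_mult_distrib)
  moreover have "(\<lambda>x. (rep_ae_fun (c *\<^sub>R y) x)\<^sup>2) \<in> borel_measurable lebesgue"
    "(\<lambda>x. c\<^sup>2 * (rep_ae_fun y x)\<^sup>2) \<in> borel_measurable lebesgue"
    by (intro borel_measurable_power borel_measurable_times borel_measurable_const
        rep_ae_fun_measurable)+
  ultimately show ?thesis
    using S by (subst set_integrable_cong_AE)
qed

lemma L2_inner_diff_left:
  assumes "S \<in> sets lebesgue" "sq_integrable S y" "sq_integrable S y'" "sq_integrable S v"
  shows "L2_inner S (y - y') v = L2_inner S y v - L2_inner S y' v"
  using L2_inner_add_left[OF assms(1,2) sq_integrable_scaleR[OF assms(1,3)] assms(4), of "-1"]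
    L2_inner_scaleR_left[OF assms(1), of "-1" y' v]
  by simp

lemma L2_inner_commute: "L2_inner S y v = L2_inner S v y"
  by (simp add: L2_inner_def mult.commute)

lemma L2_inner_self_nonneg: "0 \<le> L2_inner S y y"
  unfolding L2_inner_def set_lebesgue_integral_def
  by (rule Bochner_Integration.integral_nonneg) (simp add: indicator_def)

lemma bilinear_form_on_L2_inner:
  assumes "S \<in> sets lebesgue" and "\<And>y. y \<in> V \<Longrightarrow> sq_integrable S y"
  shows "bilinear_form_on V V (L2_inner S)"
proof -
  have left: "linear_form_on V (\<lambda>y. L2_inner S y v)" if "v \<in> V" for v
    unfolding linear_form_on_def
    using L2_inner_add_left[OF assms(1)] L2_inner_scaleR_left[OF assms(1)] assms(2) that by blast
  then have "linear_form_on V (\<lambda>y. L2_inner S v y)" if "v \<in> V" for v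
    using that by (subst L2_inner_commute)
  with left show ?thesis by (simp add: bilinear_form_on_def)
qed

lemma sq_integrable_subset:
  "sq_integrable S y \<Longrightarrow> T \<in> sets lebesgue \<Longrightarrow> T \<subseteq> S \<Longrightarrow> sq_integrable T y"
  by (rule set_integrable_subset)

lemma L2_inner_self_mono:
  assumes "sq_integrable S y" "T \<in> sets lebesgue" "T \<subseteq> S"
  shows "L2_inner T y y \<le> L2_inner S y y"
  using sq_integrable_subset[OF assms] assms(1,3)
  unfolding L2_inner_def set_lebesgue_integral_def set_integrable_def
  by (intro Bochner_Integration.integral_mono)
    (auto simp: power2_eq_square indicator_def)

text \<open>Shrinking the domain and dropping the derivative terms can only decrease a sum of
  squares. Together with the norm equivalence this is the source of every factor
  \<open>1 / \<rho>\<^sub>1\<close>.\<close>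

lemma L2_inner_self_le_H1_norm:
  assumes "y \<in> H1 \<Omega>" "T \<in> sets lebesgue" "T \<subseteq> \<Omega>"
  shows "L2_inner T y y \<le> (H1_norm \<Omega> y)\<^sup>2"
proof -
  have "L2_inner T y y \<le> L2_inner \<Omega> y y"
    using assms by (intro L2_inner_self_mono) (auto simp: H1_def L2_def)
  also have "\<dots> \<le> (H1_norm \<Omega> y)\<^sup>2"
    unfolding H1_norm_def by (simp add: sum_nonneg L2_inner_self_nonneg)
  finally show ?thesis .
qed

section \<open>Error estimates\<close>

text \<open>\<open>E\<close> is eliminated by \<open>B * E - E\<^sup>2 \<le> B * B\<close>. If the
  claim failed, \<open>D = s * U - A / s\<close> would exceed \<open>B\<close>, and then
  \<open>\<alpha> * U\<^sup>2 - A * U = (s * U) * D \<ge> D * D > B * B\<close> contradicts the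
  hypothesis.\<close>

lemma quadratic_error_bound:
  fixes \<alpha> A B E U :: real
  assumes "\<alpha> > 0" "0 \<le> A" "0 \<le> B" "0 \<le> U" and le: "\<alpha> * U\<^sup>2 + E\<^sup>2 \<le> A * U + B * E"
  shows "U \<le> A / \<alpha> + B / sqrt \<alpha>"
proof (rule ccontr)
  assume neg: "\<not> ?thesis"
  define s where "s = sqrt \<alpha>"
  have s: "0 < s" "\<alpha> = s\<^sup>2" using assms by (auto simp: s_def)
  define D where "D = s * U - A / s"
  have "s * (A / \<alpha> + B / sqrt \<alpha>) < s * U" using neg s by simp
  moreover have "s * (A / \<alpha> + B / sqrt \<alpha>) = A / s + B"
    unfolding s_def[symmetric] s(2) using s(1) by (simp add: field_simps power2_eq_square)
  ultimately have D: "B < D" by (simp add: D_def)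
  have "\<alpha> * U\<^sup>2 - A * U = (s * U) * D"
    using s by (simp add: D_def field_simps power2_eq_square)
  moreover have "D \<le> s * U" using s assms by (simp add: D_def)
  then have "D * D \<le> (s * U) * D" using D assms by (intro mult_right_mono) auto
  moreover have "B * B < D * D" using D assms by (intro mult_strict_mono') auto
  moreover have "B * E - E\<^sup>2 \<le> B * B"
    using sum_squares_bound[of B E] zero_le_square[of B] zero_le_square[of E]
    unfolding power2_eq_square mult.assoc by linarith
  ultimately show False using le by linarith
qed

text \<open>This shows where \<open>c1\<close> and \<open>c2\<close> come from: \<open>U\<close>
  bounds the control error, \<open>(\<kappa> * U + r) / \<beta>\<close> the state error, and the
  remaining terms the adjoint error; they are then sorted by \<open>r\<close> and
  \<open>s\<close>.\<close>

lemma upper_constants_identity: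
  fixes \<beta> \<kappa> \<rho> \<alpha> r s :: real
  defines "U \<equiv> \<kappa> * s / (\<beta> * \<alpha>) + r / (\<beta> * \<rho> * sqrt \<alpha>)"
  shows "U + (1 + 1 / (\<rho>\<^sup>2 * \<beta>)) * ((\<kappa> * U + r) / \<beta>) + s / \<beta> = c1 \<beta> \<kappa> \<rho> \<alpha> * r + c2 \<beta> \<kappa> \<rho> \<alpha> * s"
  unfolding U_def c1_def c2_def by (simp add: divide_inverse algebra_simps power2_eq_square)

text \<open>Here \<open>m\<close> stands for the L2 product on \<open>\<Omega>\<^sub>0\<close>.
  Optimality enters only through the error equations \<open>ry\<close>, \<open>rp\<close> and the
  inequality \<open>var\<close>, so the estimates become pure linear algebra. The finite spanning
  set \<open>B\<close> serves the lifting of residuals.\<close>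

context
  fixes Y :: "'v::real_vector set" and ip m a :: "'v \<Rightarrow> 'v \<Rightarrow> real" and b :: "'u::real_inner \<Rightarrow> 'v \<Rightarrow> real"
    and ry rp :: "'v \<Rightarrow> real" and eu :: 'u and ey ep :: 'v
    and n :: "'v \<Rightarrow> real" and \<gamma> \<beta> \<kappa> \<rho> \<alpha> r s :: real and B
  assumes Y: "subspace Y" and B: "finite B" "span B = Y"
    and ip: "inner_product_on Y ip"
    and n_def: "n = ip_norm ip"
    and a: "bilinear_form_on Y Y a" and b: "bilinear_form_on UNIV Y b"
    and m: "bilinear_form_on Y Y m" "\<And>v w. v \<in> Y \<Longrightarrow> w \<in> Y \<Longrightarrow> m v w = m w v"
      "\<And>v. v \<in> Y \<Longrightarrow> 0 \<le> m v v"
    and mn: "\<And>v. v \<in> Y \<Longrightarrow> sqrt (m v v) \<le> n v / \<rho>"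
    and eY: "ey \<in> Y" "ep \<in> Y"
    and pos: "0 < \<alpha>" "0 < \<rho>" "0 < \<beta>" "0 \<le> \<kappa>"
    and a_bd: "\<And>v w. v \<in> Y \<Longrightarrow> w \<in> Y \<Longrightarrow> \<bar>a v w\<bar> \<le> \<gamma> * n v * n w"
    and a_co: "\<And>v. v \<in> Y \<Longrightarrow> \<beta> * (n v)\<^sup>2 \<le> a v v"
    and b_bd: "\<And>w v. v \<in> Y \<Longrightarrow> \<bar>b w v\<bar> \<le> \<kappa> * norm w * n v"
    and ry: "\<And>v. v \<in> Y \<Longrightarrow> ry v = a ey v - b eu v"
    and rp: "\<And>v. v \<in> Y \<Longrightarrow> rp v = a v ep - m ey v"
    and var: "\<alpha> * (norm eu)\<^sup>2 \<le> - b eu ep"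
    and r_def: "r = dual_norm Y n ry" and s_def: "s = dual_norm Y n rp"
begin

section \<open>Residuals and their dual norms\<close>

lemma n_nonneg: "v \<in> Y \<Longrightarrow> 0 \<le> n v"
  unfolding n_def using ip by (rule ip_norm_nonneg)

lemma m_Cauchy_Schwarz: "v \<in> Y \<Longrightarrow> w \<in> Y \<Longrightarrow> \<bar>m v w\<bar> \<le> sqrt (m v v) * sqrt (m w w)"
  by (rule Cauchy_Schwarz_bilinear_form_on[OF m(1) Y m(2,3)])

lemma m_bound: assumes "v \<in> Y" "w \<in> Y" shows "\<bar>m v w\<bar> \<le> n v * n w / \<rho>\<^sup>2"
proof -
  have "\<bar>m v w\<bar> \<le> sqrt (m v v) * sqrt (m w w)" by (rule m_Cauchy_Schwarz[OF assms])
  also have "\<dots> \<le> (n v / \<rho>) * (n w / \<rho>)"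
    using mn assms m(3) n_nonneg pos by (intro mult_mono) auto
  finally show ?thesis by (simp add: power2_eq_square)
qed

lemma ry_linear: "linear_form_on Y ry"
  using bilinear_form_on_right[OF a eY(1)] bilinear_form_on_right[OF b, of eu]
  by (simp add: linear_form_on_def ry subspace_add[OF Y] subspace_scale[OF Y] right_diff_distrib)

lemma rp_linear: "linear_form_on Y rp"
  using bilinear_form_on_left[OF a eY(2)] bilinear_form_on_right[OF m(1) eY(1)]
  by (simp add: linear_form_on_def rp subspace_add[OF Y] subspace_scale[OF Y] right_diff_distrib)

text \<open>This estimate and \<open>rp_le\<close> serve twice: they make the dual norms finite, and
  through \<open>dual_norm_le\<close> they yield the lower bound.\<close>

lemma ry_le: "v \<in> Y \<Longrightarrow> ry v \<le> (\<gamma> * n ey + \<kappa> * norm eu) * n v"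
  using a_bd[OF eY(1), of v] b_bd[of v eu] ry[of v] by (simp add: abs_le_iff algebra_simps)

lemma rp_le: "v \<in> Y \<Longrightarrow> rp v \<le> (\<gamma> * n ep + n ey / \<rho>\<^sup>2) * n v"
  using a_bd[OF _ eY(2), of v] m_bound[OF eY(1), of v] rp[of v]
  by (simp add: abs_le_iff algebra_simps)

lemma r_bound: "v \<in> Y \<Longrightarrow> \<bar>ry v\<bar> \<le> r * n v"
  using abs_le_dual_norm[OF ip Y ry_linear] ry_le unfolding r_def n_def by blast

lemma s_bound: "v \<in> Y \<Longrightarrow> \<bar>rp v\<bar> \<le> s * n v"
  using abs_le_dual_norm[OF ip Y rp_linear] rp_le unfolding s_def n_def by blast

lemma r_nonneg: "0 \<le> r"
  using dual_norm_nonneg[OF ip Y ry_linear] ry_le unfolding r_def n_def by blast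

lemma s_nonneg: "0 \<le> s"
  using dual_norm_nonneg[OF ip Y rp_linear] rp_le unfolding s_def n_def by blast

section \<open>Upper bounds for the three errors\<close>

lemma coercive_bound:
  assumes "v \<in> Y" "a v v \<le> C * n v" "0 \<le> C"
  shows "n v \<le> C / \<beta>"
proof (cases "n v = 0")
  case False
  then have "0 < n v" using n_nonneg[OF assms(1)] by simp
  moreover have "(\<beta> * n v) * n v \<le> C * n v"
    using a_co[OF assms(1)] assms(2) by (simp add: power2_eq_square mult.assoc)
  ultimately have "\<beta> * n v \<le> C" by simp
  then show ?thesis using pos by (simp add: field_simps)
qed (use assms pos in simp)

text \<open>The state error equation is tested with \<open>ey\<close> itself; likewise
  \<open>ep_bound\<close> tests the adjoint one with \<open>ep\<close>.\<close>

lemma ey_bound: "n ey \<le> (\<kappa> * norm eu + r) / \<beta>"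
proof (rule coercive_bound[OF eY(1)])
  show "a ey ey \<le> (\<kappa> * norm eu + r) * n ey"
    using ry[OF eY(1)] r_bound[OF eY(1)] b_bd[OF eY(1), of eu] by (simp add: algebra_simps)
qed (use pos r_nonneg in simp)

lemma ep_bound: "n ep \<le> (n ey / \<rho>\<^sup>2 + s) / \<beta>"
proof (rule coercive_bound[OF eY(2)])
  show "a ep ep \<le> (n ey / \<rho>\<^sup>2 + s) * n ep"
    using rp[OF eY(2)] s_bound[OF eY(2)] m_bound[OF eY] by (simp add: algebra_simps)
qed (use n_nonneg[OF eY(1)] s_nonneg in simp)

text \<open>Lifting the residuals to \<open>w\<close> and \<open>q\<close> avoids the product of the two residual norms that
  estimating \<open>ry ep - rp ey\<close> directly would produce.\<close>

lemma eu_bound: "norm eu \<le> \<kappa> * s / (\<beta> * \<alpha>) + r / (\<beta> * \<rho> * sqrt \<alpha>)"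
proof -
  have posdef: "0 < a v v" if "v \<in> Y" "v \<noteq> 0" for v
  proof -
    have "0 < \<beta> * (n v)\<^sup>2" using ip_norm_pos[OF ip that] pos by (simp add: n_def)
    then show ?thesis using a_co[OF that(1)] by linarith
  qed
  obtain w where w: "w \<in> Y" "\<And>v. v \<in> Y \<Longrightarrow> a w v = ry v"
    using lax_milgram_span[OF B(1), unfolded B(2), OF a posdef ry_linear] by blast
  obtain q where q: "q \<in> Y" "\<And>v. v \<in> Y \<Longrightarrow> a v q = rp v"
    using lax_milgram_span[OF B(1), unfolded B(2), OF bilinear_form_on_flip[OF a] posdef rp_linear]
    by blast
  have nw: "n w \<le> r / \<beta>"
    using coercive_bound[OF w(1) _ r_nonneg] w r_bound[OF w(1)] by (simp add: abs_le_iff)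
  have nq: "n q \<le> s / \<beta>"
    using coercive_bound[OF q(1) _ s_nonneg] q s_bound[OF q(1)] by (simp add: abs_le_iff)
  let ?E = "sqrt (m ey ey)"
  have epq: "ep - q \<in> Y" and eyw: "ey - w \<in> Y" using eY w q Y by (auto simp: subspace_diff)
  \<comment> \<open>Subtracting the lifts removes the residuals from both error equations, so the
    following chain consists of exact equalities.\<close>
  have "b eu ep = b eu q + b eu (ep - q)"
    using linear_form_on_diff[OF bilinear_form_on_right[OF b] Y eY(2) q(1)] by simp
  also have "b eu (ep - q) = a (ey - w) (ep - q)"
    using linear_form_on_diff[OF bilinear_form_on_left[OF a epq] Y eY(1) w(1)] w(2)[OF epq] ry[OF epq]
    by simp
  also have "\<dots> = m ey (ey - w)"
    using linear_form_on_diff[OF bilinear_form_on_right[OF a eyw] Y eY(2) q(1)] q(2)[OF eyw] rp[OF eyw]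
    by simp
  also have "\<dots> = m ey ey - m ey w"
    using linear_form_on_diff[OF bilinear_form_on_right[OF m(1) eY(1)] Y eY(1) w(1)] .
  finally have "\<alpha> * (norm eu)\<^sup>2 + m ey ey \<le> \<bar>b eu q\<bar> + \<bar>m ey w\<bar>" using var by simp
  moreover have "\<bar>b eu q\<bar> \<le> (\<kappa> * s / \<beta>) * norm eu"
    using b_bd[OF q(1), of eu] mult_left_mono[OF nq, of "\<kappa> * norm eu"] pos
    by (simp add: algebra_simps)
  \<comment> \<open>The factor \<open>?E\<close> is kept instead of \<open>n ey\<close>, so that
    this term can be absorbed by \<open>?E\<^sup>2\<close> on the left.\<close>
  moreover have "\<bar>m ey w\<bar> \<le> (r / (\<beta> * \<rho>)) * ?E"
  proof -
    have "sqrt (m w w) \<le> r / \<beta> / \<rho>"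
      using mn[OF w(1)] divide_right_mono[OF nw, of \<rho>] pos by linarith
    then have "?E * sqrt (m w w) \<le> ?E * (r / \<beta> / \<rho>)"
      using m(3)[OF eY(1)] by (intro mult_left_mono) auto
    then show ?thesis using m_Cauchy_Schwarz[OF eY(1) w(1)] by (simp add: mult.commute)
  qed
  ultimately have "\<alpha> * (norm eu)\<^sup>2 + ?E\<^sup>2 \<le> (\<kappa> * s / \<beta>) * norm eu + (r / (\<beta> * \<rho>)) * ?E"
    using m(3)[OF eY(1)] by simp
  then have "norm eu \<le> (\<kappa> * s / \<beta>) / \<alpha> + (r / (\<beta> * \<rho>)) / sqrt \<alpha>"
    using pos r_nonneg s_nonneg by (intro quadratic_error_bound) auto
  then show ?thesis by simp
qed

lemma error_upper_bound:
  "norm eu + n ey + n ep \<le> c1 \<beta> \<kappa> \<rho> \<alpha> * r + c2 \<beta> \<kappa> \<rho> \<alpha> * s"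
proof -
  define U where "U = \<kappa> * s / (\<beta> * \<alpha>) + r / (\<beta> * \<rho> * sqrt \<alpha>)"
  have "norm eu \<le> U" using eu_bound by (simp add: U_def)
  moreover from this have ey: "n ey \<le> (\<kappa> * U + r) / \<beta>"
    using ey_bound pos
    by (smt (verit) divide_right_mono mult_left_mono)
  moreover have "n ep \<le> 1 / (\<rho>\<^sup>2 * \<beta>) * ((\<kappa> * U + r) / \<beta>) + s / \<beta>"
  proof -
    have "n ep \<le> 1 / (\<rho>\<^sup>2 * \<beta>) * n ey + s / \<beta>" using ep_bound by (simp add: add_divide_distrib)
    also have "\<dots> \<le> 1 / (\<rho>\<^sup>2 * \<beta>) * ((\<kappa> * U + r) / \<beta>) + s / \<beta>"
      using ey pos by (intro add_right_mono mult_left_mono) auto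
    finally show ?thesis .
  qed
  ultimately have "norm eu + n ey + n ep
      \<le> U + (1 + 1 / (\<rho>\<^sup>2 * \<beta>)) * ((\<kappa> * U + r) / \<beta>) + s / \<beta>"
    unfolding distrib_right by simp
  then show ?thesis
    using upper_constants_identity[of \<kappa> s \<beta> \<alpha> r \<rho>] by (simp add: U_def)
qed

text \<open>The state error occurs in the estimates of both residuals. The factor 1/2 in
  \<open>c3\<close> and \<open>c4\<close> lets each residual claim half of it.\<close>

lemma error_lower_bound:
  assumes "\<beta> \<le> \<gamma>"
  shows "c3 \<gamma> \<beta> \<kappa> * r + c4 \<gamma> \<beta> \<rho> * s \<le> norm eu + n ey + n ep"
proof -
  have g: "0 < \<gamma>" using assms pos by simp
  have nn: "0 \<le> n ey" "0 \<le> n ep" using n_nonneg eY by auto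
  have r: "r \<le> \<gamma> * n ey + \<kappa> * norm eu"
    unfolding r_def n_def
    using dual_norm_le[OF ip Y ry_linear] ry_le g pos nn unfolding n_def by simp
  have s: "s \<le> \<gamma> * n ep + n ey / \<rho>\<^sup>2"
    unfolding s_def n_def
    using dual_norm_le[OF ip Y rp_linear] rp_le g pos nn unfolding n_def by simp
  \<comment> \<open>Both \<open>c3\<close> and \<open>c4\<close> have this shape, with \<open>k = \<kappa>\<close> and \<open>k = 1 / \<rho>\<^sup>2\<close>.\<close>
  have gen: "1 / (2 * \<gamma>) * inverse (max (k / \<beta>) 1) * t \<le> (A + D) / 2"
    if t: "t \<le> \<gamma> * A + k * D" and AD: "0 \<le> A" "0 \<le> D" for k t A D
  proof -
    define M where "M = max (k / \<beta>) 1"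
    have M: "k / \<beta> \<le> M" "1 \<le> M" by (simp_all add: M_def)
    have "k \<le> \<beta> * M" using M(1) pos by (simp add: pos_divide_le_eq mult.commute)
    \<comment> \<open>The maximum is formed with \<beta>; passing to \<gamma> makes
      \<open>\<gamma> * M\<close> a common bound for the coefficients of \<open>A\<close> and
      \<open>D\<close>.\<close>
    also have "\<dots> \<le> \<gamma> * M" using assms M(2) by (intro mult_right_mono) auto
    finally have "k * D \<le> \<gamma> * M * D" using AD by (intro mult_right_mono) auto
    moreover have "\<gamma> * 1 * A \<le> \<gamma> * M * A"
      using g AD M(2) by (intro mult_right_mono mult_left_mono) auto
    ultimately have "t \<le> (2 * \<gamma> * M) * ((A + D) / 2)" using t by (simp add: algebra_simps)
    then have "t / (2 * \<gamma> * M) \<le> (A + D) / 2"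
      using g M(2) by (simp add: divide_le_eq mult.commute)
    moreover have "1 / (2 * \<gamma>) * inverse M * t = t / (2 * \<gamma> * M)"
      by (simp add: inverse_eq_divide)
    ultimately show ?thesis unfolding M_def by linarith
  qed
  have "c3 \<gamma> \<beta> \<kappa> * r \<le> (n ey + norm eu) / 2"
    unfolding c3_def by (rule gen[OF r nn(1) norm_ge_zero])
  moreover have "c4 \<gamma> \<beta> \<rho> * s \<le> (n ep + n ey) / 2"
    unfolding c4_def using gen[of s "n ep" "1 / \<rho>\<^sup>2" "n ey"] s nn by simp
  ultimately show ?thesis using nn norm_ge_zero[of eu] by argo
qed

end

section \<open>Reduction of the finite element setting to the abstract estimates\<close>

theorem theorem4p2:
  fixes P :: "(real ^ 'p) set"
    and \<Omega> \<Omega>\<^sub>0 :: "(real ^ 'd) set"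
    and Y Y\<^sub>N :: "(real ^ 'd) ae_fun set"
    and ipY :: "(real ^ 'd) ae_fun \<Rightarrow> (real ^ 'd) ae_fun \<Rightarrow> real"
    and Uad :: "'u::{real_inner, complete_space} set"
    and a :: "real ^ 'p \<Rightarrow> (real ^ 'd) ae_fun \<Rightarrow> (real ^ 'd) ae_fun \<Rightarrow> real"
    and b :: "real ^ 'p \<Rightarrow> 'u \<Rightarrow> (real ^ 'd) ae_fun \<Rightarrow> real"
    and f :: "real ^ 'p \<Rightarrow> (real ^ 'd) ae_fun \<Rightarrow> real"
    and z y p y\<^sub>N p\<^sub>N :: "(real ^ 'd) ae_fun"
    and u u\<^sub>N :: 'u
    and \<alpha> \<rho>\<^sub>1 \<rho>\<^sub>2 \<gamma>\<^sub>0 \<beta>\<^sub>0 \<kappa>\<^sub>0 \<sigma>\<^sub>0 :: real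
    and \<mu> :: "real ^ 'p"
  defines "nY \<equiv> ip_norm ipY"
  defines "\<gamma> \<equiv> \<lambda>\<mu>. continuity_const Y nY Y nY (a \<mu>)"
    and "\<beta> \<equiv> \<lambda>\<mu>. coercivity_const Y nY (a \<mu>)"
    and "\<kappa> \<equiv> \<lambda>\<mu>. continuity_const UNIV norm Y nY (b \<mu>)"
  defines "\<gamma>' \<equiv> real_of_ereal (\<gamma> \<mu>)"
    and "\<beta>' \<equiv> real_of_ereal (\<beta> \<mu>)"
    and "\<kappa>' \<equiv> real_of_ereal (\<kappa> \<mu>)"
    and "norm_ry \<equiv> dual_norm Y nY (state_residual (a \<mu>) (b \<mu>) (f \<mu>) u\<^sub>N y\<^sub>N)"
    and "norm_rp \<equiv> dual_norm Y nY (adjoint_residual \<Omega>\<^sub>0 z (a \<mu>) y\<^sub>N p\<^sub>N)"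
  assumes "compact P"
    and "CARD('d) \<in> {1, 2, 3}"
    and "open \<Omega>" and "connected \<Omega>" and "bounded \<Omega>" and "\<Omega> \<noteq> {}"
    and "open \<Omega>\<^sub>0" and "\<Omega>\<^sub>0 \<subseteq> \<Omega>"
    and "P1_finite_element_space \<Omega> Y"
    and "inner_product_on Y ipY"
    and "\<rho>\<^sub>1 > 0" and "\<rho>\<^sub>2 > 0"
    and "\<forall>y\<in>Y. \<rho>\<^sub>1 * H1_norm \<Omega> y \<le> nY y \<and> nY y \<le> \<rho>\<^sub>2 * H1_norm \<Omega> y"
    and "Uad \<noteq> {}" and "closed Uad" and "convex Uad"
    and "z \<in> L2 \<Omega>\<^sub>0" and "\<alpha> > 0"
    and "\<beta>\<^sub>0 > 0"
    and "\<forall>\<mu>\<in>P. bilinear_form_on Y Y (a \<mu>) \<and> \<gamma> \<mu> \<le> ereal \<gamma>\<^sub>0 \<and> \<beta> \<mu> \<ge> ereal \<beta>\<^sub>0"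
    and "\<forall>\<mu>\<in>P. bilinear_form_on UNIV Y (b \<mu>) \<and> \<kappa> \<mu> \<le> ereal \<kappa>\<^sub>0"
    and "\<forall>\<mu>\<in>P. linear_form_on Y (f \<mu>) \<and> functional_bound Y nY (f \<mu>) \<le> ereal \<sigma>\<^sub>0"
    and "\<mu> \<in> P"
    and "subspace Y\<^sub>N" and "Y\<^sub>N \<subseteq> Y"
    and "optimality_system \<Omega>\<^sub>0 z \<alpha> Uad Y (a \<mu>) (b \<mu>) (f \<mu>) u y p"
    and "optimality_system \<Omega>\<^sub>0 z \<alpha> Uad Y\<^sub>N (a \<mu>) (b \<mu>) (f \<mu>) u\<^sub>N y\<^sub>N p\<^sub>N"
  shows "c3 \<gamma>' \<beta>' \<kappa>' * norm_ry + c4 \<gamma>' \<beta>' \<rho>\<^sub>1 * norm_rp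
           \<le> norm (u - u\<^sub>N) + nY (y - y\<^sub>N) + nY (p - p\<^sub>N) \<and>
         norm (u - u\<^sub>N) + nY (y - y\<^sub>N) + nY (p - p\<^sub>N)
           \<le> c1 \<beta>' \<kappa>' \<rho>\<^sub>1 \<alpha> * norm_ry + c2 \<beta>' \<kappa>' \<rho>\<^sub>1 \<alpha> * norm_rp"
proof -
  have Y: "subspace Y" and YH1: "Y \<subseteq> H1 \<Omega>" and "\<exists>B. finite B \<and> span B = Y"
    using \<open>P1_finite_element_space \<Omega> Y\<close> by (auto simp: P1_finite_element_space_def)
  then obtain B where B: "finite B" "span B = Y" by blast
  note ip = \<open>inner_product_on Y ipY\<close>
  have a: "bilinear_form_on Y Y (a \<mu>)" and \<gamma>\<^sub>0: "continuity_const Y nY Y nY (a \<mu>) \<le> ereal \<gamma>\<^sub>0"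
    and \<beta>\<^sub>0: "ereal \<beta>\<^sub>0 \<le> coercivity_const Y nY (a \<mu>)"
    and b: "bilinear_form_on UNIV Y (b \<mu>)"
    and \<kappa>\<^sub>0: "continuity_const UNIV norm Y nY (b \<mu>) \<le> ereal \<kappa>\<^sub>0"
    using assms by auto
  have \<Omega>\<^sub>0: "\<Omega>\<^sub>0 \<in> sets lebesgue" using \<open>open \<Omega>\<^sub>0\<close> by simp
  have sqY: "sq_integrable \<Omega>\<^sub>0 v" if "v \<in> Y" for v
    using that YH1 \<open>\<Omega>\<^sub>0 \<subseteq> \<Omega>\<close> \<Omega>\<^sub>0 sq_integrable_subset[of \<Omega> v \<Omega>\<^sub>0] by (auto simp: H1_def L2_def)
  have sqz: "sq_integrable \<Omega>\<^sub>0 z" using \<open>z \<in> L2 \<Omega>\<^sub>0\<close> by (simp add: L2_def)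
  have opt: "u \<in> Uad" "y \<in> Y" "p \<in> Y" "\<And>v. v \<in> Y \<Longrightarrow> a \<mu> y v = b \<mu> u v + f \<mu> v"
      "\<And>v. v \<in> Y \<Longrightarrow> a \<mu> v p = L2_inner \<Omega>\<^sub>0 (y - z) v"
      "\<And>v. v \<in> Uad \<Longrightarrow> 0 \<le> b \<mu> (v - u) p + \<alpha> * (u \<bullet> (v - u))"
    and optN: "u\<^sub>N \<in> Uad" "y\<^sub>N \<in> Y" "p\<^sub>N \<in> Y"
      "\<And>v. v \<in> Uad \<Longrightarrow> 0 \<le> b \<mu> (v - u\<^sub>N) p\<^sub>N + \<alpha> * (u\<^sub>N \<bullet> (v - u\<^sub>N))"
    using assms by (auto simp: optimality_system_def)
  have eY: "y - y\<^sub>N \<in> Y" "p - p\<^sub>N \<in> Y" using opt optN Y by (auto simp: subspace_diff)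
  have n0: "nY 0 = 0" and npos: "\<And>v. v \<in> Y \<Longrightarrow> v \<noteq> 0 \<Longrightarrow> 0 < nY v"
    and nnn: "\<And>v. v \<in> Y \<Longrightarrow> 0 \<le> nY v"
    using ip_norm_zero[OF ip subspace_0[OF Y]] ip_norm_pos[OF ip] ip_norm_nonneg[OF ip]
    by (auto simp: nY_def)
  have L2_bound: "sqrt (L2_inner \<Omega>\<^sub>0 v v) \<le> nY v / \<rho>\<^sub>1" if "v \<in> Y" for v
  proof -
    have "0 \<le> H1_norm \<Omega> v"
      unfolding H1_norm_def by (simp add: sum_nonneg L2_inner_self_nonneg)
    then have "sqrt (L2_inner \<Omega>\<^sub>0 v v) \<le> H1_norm \<Omega> v"
      using L2_inner_self_le_H1_norm[of v \<Omega> \<Omega>\<^sub>0] that YH1 \<Omega>\<^sub>0 \<open>\<Omega>\<^sub>0 \<subseteq> \<Omega>\<close> by (intro real_le_lsqrt) auto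
    also have "\<dots> \<le> nY v / \<rho>\<^sub>1"
      using assms(22) \<open>\<rho>\<^sub>1 > 0\<close> that by (simp add: field_simps)
    finally show ?thesis .
  qed
  \<comment> \<open>The exact state equation eliminates \<open>f \<mu> v\<close>, which leaves the
    error equation.\<close>
  have ry: "state_residual (a \<mu>) (b \<mu>) (f \<mu>) u\<^sub>N y\<^sub>N v = a \<mu> (y - y\<^sub>N) v - b \<mu> (u - u\<^sub>N) v"
    if "v \<in> Y" for v
    using linear_form_on_diff[OF bilinear_form_on_left[OF a that] Y opt(2) optN(2)]
      linear_form_on_diff[OF bilinear_form_on_left[OF b that] subspace_UNIV, of u u\<^sub>N] opt(4)[OF that]
    by (simp add: state_residual_def)
  \<comment> \<open>The target \<open>z\<close> is only known to lie in
    \<open>L2 \<Omega>\<^sub>0\<close>, so bilinearity on \<open>Y\<close> does not cover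
    \<open>v - z\<close>.\<close>
  have L2_diff: "L2_inner \<Omega>\<^sub>0 (v - z) w = L2_inner \<Omega>\<^sub>0 v w - L2_inner \<Omega>\<^sub>0 z w"
    if "v \<in> Y" "w \<in> Y" for v w
    using L2_inner_diff_left[OF \<Omega>\<^sub>0 sqY sqz sqY] that .
  have rp: "adjoint_residual \<Omega>\<^sub>0 z (a \<mu>) y\<^sub>N p\<^sub>N v = a \<mu> v (p - p\<^sub>N) - L2_inner \<Omega>\<^sub>0 (y - y\<^sub>N) v"
    if "v \<in> Y" for v
    using linear_form_on_diff[OF bilinear_form_on_right[OF a that] Y opt(3) optN(3)]
      linear_form_on_diff[OF bilinear_form_on_left[OF bilinear_form_on_L2_inner[OF \<Omega>\<^sub>0 sqY] that] Y opt(2) optN(2)]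
      opt(5)[OF that] L2_diff[OF opt(2) that] L2_diff[OF optN(2) that]
    by (simp add: adjoint_residual_def)
  \<comment> \<open>The two variational inequalities are tested with each other's control and
    added.\<close>
  have var: "\<alpha> * (norm (u - u\<^sub>N))\<^sup>2 \<le> - b \<mu> (u - u\<^sub>N) (p - p\<^sub>N)"
  proof -
    have "b \<mu> (u\<^sub>N - u) p = - b \<mu> (u - u\<^sub>N) p"
      using linear_form_on_minus[OF bilinear_form_on_left[OF b opt(3)], of "u - u\<^sub>N"] by simp
    moreover have "\<alpha> * (u \<bullet> (u\<^sub>N - u)) + \<alpha> * (u\<^sub>N \<bullet> (u - u\<^sub>N)) = - \<alpha> * (norm (u - u\<^sub>N))\<^sup>2"
      by (simp add: power2_norm_eq_inner inner_diff_left inner_diff_right inner_commute algebra_simps)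
    ultimately show ?thesis
      using opt(6)[OF optN(1)] optN(4)[OF opt(1)]
        linear_form_on_diff[OF bilinear_form_on_right[OF b] Y opt(3) optN(3), of "u - u\<^sub>N"]
      by simp
  qed
  show ?thesis
  \<comment> \<open>On the trivial space the coercivity infimum is \<infinity> and
    \<open>\<beta>'\<close> becomes 0, so the abstract setting does not apply. There the residual
    norms and the state and adjoint errors vanish, and \<open>var\<close> forces
    \<open>u = u\<^sub>N\<close>.\<close>
  proof (cases "Y = {0}")
    case True
    have "norm_ry = 0" "norm_rp = 0"
      using True n0 by (auto simp: norm_ry_def norm_rp_def dual_norm_def bot_ereal_def cong: conj_cong)
    moreover have "p - p\<^sub>N = 0" "y - y\<^sub>N = 0" using eY True by auto
    moreover from this have "\<alpha> * (norm (u - u\<^sub>N))\<^sup>2 \<le> 0"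
      using var linear_form_on_zero[OF bilinear_form_on_right[OF b] subspace_0[OF Y]] by simp
    then have "norm (u - u\<^sub>N) = 0" using \<open>\<alpha> > 0\<close> by (simp add: mult_le_0_iff)
    ultimately show ?thesis using n0 by simp
  next
    case False
    then obtain v where v: "v \<in> Y" "v \<noteq> 0" using subspace_0[OF Y] by auto
    have \<beta>_pos: "0 < \<beta>'"
      using coercivity_const_finite(1)[OF \<beta>\<^sub>0 v] \<open>\<beta>\<^sub>0 > 0\<close> by (simp add: \<beta>'_def \<beta>_def)
    have a_co: "\<beta>' * (nY w)\<^sup>2 \<le> a \<mu> w w" if "w \<in> Y" for w
    proof (cases "w = 0")
      case True
      then show ?thesis
        using n0 linear_form_on_zero[OF bilinear_form_on_right[OF a]] subspace_0[OF Y] by simp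
    next
      case False
      then show ?thesis
        using coercivity_const_finite(2)[OF \<beta>\<^sub>0 that False] npos[OF that False]
        by (simp add: \<beta>'_def \<beta>_def field_simps)
    qed
    have a_bd: "\<bar>a \<mu> v w\<bar> \<le> \<gamma>' * nY v * nY w" if "v \<in> Y" "w \<in> Y" for v w
      unfolding \<gamma>'_def \<gamma>_def
      using \<gamma>\<^sub>0 a npos n0 npos n0 that by (rule abs_le_continuity_const)
    have b_bd: "\<bar>b \<mu> w v\<bar> \<le> \<kappa>' * norm w * nY v" if "v \<in> Y" for w v
      unfolding \<kappa>'_def \<kappa>_def
      by (rule abs_le_continuity_const[OF \<kappa>\<^sub>0 b _ _ npos n0 UNIV_I that]) auto
    have \<kappa>_nonneg: "0 \<le> \<kappa>'"
      unfolding \<kappa>'_def \<kappa>_def by (rule continuity_const_nonneg) (auto simp: nnn)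
    \<comment> \<open>Testing coercivity and continuity with the same nonzero \<open>v\<close>
      compares the two constants.\<close>
    have "\<beta>' * (nY v)\<^sup>2 \<le> \<gamma>' * (nY v)\<^sup>2"
      using a_co[OF v(1)] a_bd[OF v(1) v(1)] by (simp add: power2_eq_square)
    then have \<beta>\<gamma>: "\<beta>' \<le> \<gamma>'" using npos[OF v] by simp
    \<comment> \<open>The facts follow the order of the assumptions of the abstract context, with
      \<open>L2_inner \<Omega>\<^sub>0\<close> for \<open>m\<close>.\<close>
    note setting = Y B ip nY_def[THEN meta_eq_to_obj_eq] a b bilinear_form_on_L2_inner[OF \<Omega>\<^sub>0 sqY]
      L2_inner_commute L2_inner_self_nonneg L2_bound eY \<open>\<alpha> > 0\<close> \<open>\<rho>\<^sub>1 > 0\<close> \<beta>_pos \<kappa>_nonneg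
      a_bd a_co b_bd ry rp var norm_ry_def[THEN meta_eq_to_obj_eq] norm_rp_def[THEN meta_eq_to_obj_eq]
    show ?thesis
      using error_lower_bound[OF setting \<beta>\<gamma>] error_upper_bound[OF setting] by blast
  qed
qed

end
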